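(* Let $H$ be a regular Fourier hypergroup with left Haar measure $m_H$. Let $\mathcal{L}A(H)=L^1(H)\cap A(H)$ and $|||f|||=\|f\|_1+\|f\|_{A(H)}$ for $f\in\mathcal{L}A(H)$. Then $(\mathcal{L}A(H),|||\cdot|||)$ with the pointwise multiplication is a Banach algebra.
   Context: A hypergroup (in the sense of Jewett) is a nonempty locally compact Hausdorff space $H$ together with a bilinear associative product (convolution) $*$ on the space $M(H)$ of bounded complex Radon measures such that: $\delta_x*\delta_y$ is a compactly supported probability measure for all $x,y\in H$; the convolution is continuous on nonnegative measures in the weak topology given by the test functions $C_c(H)\cup\{1\}$; $(x,y)\mapsto \mathrm{supp}(\delta_x*\delta_y)$ is continuous into the compact subsets of $H$ with the Michael topology; there is an identity $e\in H$ with $\delta_e*\delta_x=\delta_x*\delta_e=\delta_x$; there is a homeomorphic involution $x\mapsto\check{x}$ with $(\delta_x*\delta_y)\check{\ }=\delta_{\check y}*\delta_{\check x}$, and $e\in\mathrm{supp}(\delta_x*\delta_y)$ if and only if $x=\check y$. All hypergroups are assumed to admit a left Haar measure $m_H$ (a nonzero positive Radon measure with $\int f(xy)\,dm_H(y)=\int f\,dm_H$ for $f\in C_c(H)$, $x\in H$), and $dt$ means $dm_H(t)$. Here $f(xy):=\int_H f\,d(\delta_x*\delta_y)$. $L^p(H)=L^p(H,m_H)$. For $f\in L^1(H)$, $g\in L^p(H)$, $(f*g)(x)=\int_H f(y)\,g(\check y x)\,dy$. Put $\tilde f(x)=\overline{f(\check x)}$. The left regular representation $\lambda$ on $L^2(H)$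 is $\lambda(x)f(y)=f(\check x y)$, extended to $L^1(H)$ by integration. $C_\lambda^*(H)$ is the completion of $L^1(H)$ in the norm $\|f\|_{C^*_\lambda(H)}=\|\lambda(f)\|_{\mathcal{B}(L^2(H))}$, and $B_\lambda(H)=C_\lambda^*(H)^*$, whose elements are realized as functions $u$ on $H$ via $\langle u,f\rangle=\int_H u f\,dm_H$, $f\in L^1(H)$. The Fourier space $A(H)$ is the norm-closed subspace of $B_\lambda(H)$ spanned by $\{f*\tilde f: f\in C_c(H)\}$, with the norm $\|\cdot\|_{A(H)}$ of $B_\lambda(H)$; its elements are continuous functions vanishing at infinity. $H$ is a regular Fourier hypergroup if $A(H)$ is a Banach algebra with its original norm $\|\cdot\|_{A(H)}$ and pointwise product. *)

theory Defs
  imports "HOL-Analysis.Analysis"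
begin

section \<open>Radon measures\<close>

definition radon_measure :: "'a::t2_space measure \<Rightarrow> bool" where
  "radon_measure M \<longleftrightarrow>
     sets M = sets borel \<and>
     (\<forall>K. compact K \<longrightarrow> emeasure M K < \<infinity>) \<and>
     (\<forall>E\<in>sets borel. emeasure M E = (INF U\<in>{U. open U \<and> E \<subseteq> U}. emeasure M U)) \<and>
     (\<forall>U. open U \<longrightarrow> emeasure M U = (SUP K\<in>{K. compact K \<and> K \<subseteq> U}. emeasure M K))"

text \<open>Complex measures are set functions on the Borel sets, extended by 0 to all other sets, so
  that equality of measures is equality of functions.\<close>

definition variation :: "('a::topological_space set \<Rightarrow> complex) \<Rightarrow> 'a set \<Rightarrow> ennreal" where
  "variation \<mu> E =
     (SUP P\<in>{P. finite P \<and> disjoint P \<and> P \<subseteq> sets borel \<and> \<Union>P = E}. \<Sum>B\<in>P. ennreal (norm (\<mu> B)))"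

text \<open>Countable additivity forces \<open>\<mu> {} = 0\<close> and finite total variation. For a finite measure,
  inner regularity on all Borel sets is the full Radon property.\<close>

definition complex_radon :: "('a::t2_space set \<Rightarrow> complex) set" where
  "complex_radon =
     {\<mu>. (\<forall>E. E \<notin> sets borel \<longrightarrow> \<mu> E = 0) \<and>
         (\<forall>A::nat \<Rightarrow> 'a set. range A \<subseteq> sets borel \<longrightarrow> disjoint_family A \<longrightarrow>
            (\<lambda>i. \<mu> (A i)) sums \<mu> (\<Union>i. A i)) \<and>
         (\<forall>E\<in>sets borel. variation \<mu> E = (SUP K\<in>{K. compact K \<and> K \<subseteq> E}. variation \<mu> K))}"

definition nonneg_radon :: "('a::t2_space set \<Rightarrow> complex) set" where
  "nonneg_radon = {\<mu>\<in>complex_radon. \<forall>E. \<mu> E \<in> \<real>\<^sub>\<ge>\<^sub>0}"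

text \<open>Only meaningful on \<^const>\<open>nonneg_radon\<close>: the same measure as an object of the library's
  measure type, so that one can integrate against it.\<close>

definition as_measure :: "('a::topological_space set \<Rightarrow> complex) \<Rightarrow> 'a measure" where
  "as_measure \<mu> = measure_of UNIV (sets borel) (\<lambda>E. ennreal (Re (\<mu> E)))"

definition point_mass :: "'a::topological_space \<Rightarrow> 'a set \<Rightarrow> complex" where
  "point_mass x E = (if E \<in> sets borel \<and> x \<in> E then 1 else 0)"

definition supp :: "('a::topological_space set \<Rightarrow> complex) \<Rightarrow> 'a set" where
  "supp \<mu> = {x. \<forall>U. open U \<longrightarrow> x \<in> U \<longrightarrow> variation \<mu> U \<noteq> 0}"

definition Cc :: "('a::topological_space \<Rightarrow> complex) set" where
  "Cc = {f. continuous_on UNIV f \<and> compact (closure {x. f x \<noteq> 0})}"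

definition cone_topology :: "('a::t2_space set \<Rightarrow> complex) topology" where
  "cone_topology =
     topology_generated_by
       {{\<mu>\<in>nonneg_radon. (LINT x|as_measure \<mu>. f x) \<in> U} | f U. f \<in> Cc \<union> {\<lambda>_. 1} \<and> open U}"

definition michael_topology :: "'a::topological_space set topology" where
  "michael_topology =
     topology_generated_by {{K. compact K \<and> K \<inter> U \<noteq> {} \<and> K \<subseteq> V} | U V. open U \<and> open V}"


section \<open>Hypergroups\<close>

locale hypergroup =
  fixes conv :: "('a::t2_space set \<Rightarrow> complex) \<Rightarrow> ('a set \<Rightarrow> complex) \<Rightarrow> 'a set \<Rightarrow> complex"
    and e :: 'a
    and invol :: "'a \<Rightarrow> 'a"
  assumes locally_compact: "locally_compact_space (euclidean :: 'a topology)"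
    and conv_closed: "\<lbrakk>\<mu> \<in> complex_radon; \<nu> \<in> complex_radon\<rbrakk> \<Longrightarrow> conv \<mu> \<nu> \<in> complex_radon"
    and conv_add_left: "\<lbrakk>\<mu> \<in> complex_radon; \<mu>' \<in> complex_radon; \<nu> \<in> complex_radon\<rbrakk> \<Longrightarrow>
          conv (\<lambda>E. \<mu> E + \<mu>' E) \<nu> = (\<lambda>E. conv \<mu> \<nu> E + conv \<mu>' \<nu> E)"
    and conv_add_right: "\<lbrakk>\<mu> \<in> complex_radon; \<nu> \<in> complex_radon; \<nu>' \<in> complex_radon\<rbrakk> \<Longrightarrow>
          conv \<mu> (\<lambda>E. \<nu> E + \<nu>' E) = (\<lambda>E. conv \<mu> \<nu> E + conv \<mu> \<nu>' E)"
    and conv_scale_left: "\<lbrakk>\<mu> \<in> complex_radon; \<nu> \<in> complex_radon\<rbrakk> \<Longrightarrow>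
          conv (\<lambda>E. c * \<mu> E) \<nu> = (\<lambda>E. c * conv \<mu> \<nu> E)"
    and conv_scale_right: "\<lbrakk>\<mu> \<in> complex_radon; \<nu> \<in> complex_radon\<rbrakk> \<Longrightarrow>
          conv \<mu> (\<lambda>E. c * \<nu> E) = (\<lambda>E. c * conv \<mu> \<nu> E)"
    and conv_assoc: "\<lbrakk>\<mu> \<in> complex_radon; \<nu> \<in> complex_radon; \<rho> \<in> complex_radon\<rbrakk> \<Longrightarrow>
          conv (conv \<mu> \<nu>) \<rho> = conv \<mu> (conv \<nu> \<rho>)"
    and conv_point_nonneg: "conv (point_mass x) (point_mass y) \<in> nonneg_radon"
    and conv_point_prob: "conv (point_mass x) (point_mass y) UNIV = 1"
    and conv_point_compact: "compact (supp (conv (point_mass x) (point_mass y)))"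
    and conv_continuous: "continuous_map (prod_topology cone_topology cone_topology) cone_topology
          (\<lambda>(\<mu>, \<nu>). conv \<mu> \<nu>)"
    and supp_continuous: "continuous_map (euclidean :: ('a \<times> 'a) topology) michael_topology
          (\<lambda>(x, y). supp (conv (point_mass x) (point_mass y)))"
    and identity_left: "conv (point_mass e) (point_mass x) = point_mass x"
    and identity_right: "conv (point_mass x) (point_mass e) = point_mass x"
    and invol_homeomorphism: "homeomorphism UNIV UNIV invol invol"
    and invol_conv: "conv (point_mass x) (point_mass y) (invol ` E) =
          conv (point_mass (invol y)) (point_mass (invol x)) E"
    and identity_in_supp: "e \<in> supp (conv (point_mass x) (point_mass y)) \<longleftrightarrow> x = invol y"
begin

text \<open>\<open>translate f x y\<close> is the hypergroup value \<open>f(xy)\<close>.\<close>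

definition translate :: "('a \<Rightarrow> complex) \<Rightarrow> 'a \<Rightarrow> 'a \<Rightarrow> complex" where
  "translate f x y = (LINT z|as_measure (conv (point_mass x) (point_mass y)). f z)"

definition left_haar :: "'a measure \<Rightarrow> bool" where
  "left_haar m \<longleftrightarrow> radon_measure m \<and> emeasure m UNIV \<noteq> 0 \<and>
     (\<forall>f\<in>Cc. \<forall>x. (LINT y|m. translate f x y) = (LINT y|m. f y))"

end


section \<open>Function spaces\<close>

text \<open>Elements of \<open>L\<^sup>p\<close> are represented by Borel functions; the quantities below depend only on
  almost-everywhere classes.\<close>

definition L1 :: "'a measure \<Rightarrow> ('a \<Rightarrow> complex) set" where
  "L1 m = {f. integrable m f}"

definition L1_norm :: "'a measure \<Rightarrow> ('a \<Rightarrow> complex) \<Rightarrow> real" where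
  "L1_norm m f = (LINT x|m. norm (f x))"

definition L2 :: "'a measure \<Rightarrow> ('a \<Rightarrow> complex) set" where
  "L2 m = {g \<in> borel_measurable m. integrable m (\<lambda>x. (norm (g x))\<^sup>2)}"

definition L2_norm :: "'a measure \<Rightarrow> ('a \<Rightarrow> complex) \<Rightarrow> real" where
  "L2_norm m g = sqrt (LINT x|m. (norm (g x))\<^sup>2)"

definition L2_operator_norm ::
    "'a measure \<Rightarrow> (('a \<Rightarrow> complex) \<Rightarrow> ('a \<Rightarrow> complex)) \<Rightarrow> real" where
  "L2_operator_norm m T = (SUP g\<in>{g \<in> L2 m. L2_norm m g \<le> 1}. L2_norm m (T g))"

text \<open>Banach algebras of complex functions under the pointwise operations; the algebraic identities
  are inherited from the complex numbers.\<close>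

definition banach_function_algebra ::
    "('a \<Rightarrow> complex) set \<Rightarrow> (('a \<Rightarrow> complex) \<Rightarrow> real) \<Rightarrow> bool" where
  "banach_function_algebra A N \<longleftrightarrow>
     (\<lambda>_. 0) \<in> A \<and>
     (\<forall>f\<in>A. \<forall>g\<in>A. (\<lambda>x. f x + g x) \<in> A) \<and>
     (\<forall>c. \<forall>f\<in>A. (\<lambda>x. c * f x) \<in> A) \<and>
     (\<forall>f\<in>A. \<forall>g\<in>A. (\<lambda>x. f x * g x) \<in> A) \<and>
     (\<forall>f\<in>A. N f \<ge> 0) \<and>
     (\<forall>f\<in>A. N f = 0 \<longleftrightarrow> f = (\<lambda>_. 0)) \<and>
     (\<forall>c. \<forall>f\<in>A. N (\<lambda>x. c * f x) = norm c * N f) \<and>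
     (\<forall>f\<in>A. \<forall>g\<in>A. N (\<lambda>x. f x + g x) \<le> N f + N g) \<and>
     (\<forall>f\<in>A. \<forall>g\<in>A. N (\<lambda>x. f x * g x) \<le> N f * N g) \<and>
     (\<forall>F::nat \<Rightarrow> 'a \<Rightarrow> complex.
        range F \<subseteq> A \<and>
        (\<forall>\<epsilon>>0. \<exists>n0. \<forall>m\<ge>n0. \<forall>n\<ge>n0. N (\<lambda>x. F m x - F n x) < \<epsilon>) \<longrightarrow>
        (\<exists>f\<in>A. (\<lambda>n. N (\<lambda>x. F n x - f x)) \<longlonglongrightarrow> 0))"


section \<open>The Fourier space\<close>

locale haar_hypergroup = hypergroup conv e invol
  for conv :: "('a::t2_space set \<Rightarrow> complex) \<Rightarrow> ('a set \<Rightarrow> complex) \<Rightarrow> 'a set \<Rightarrow> complex"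
    and e :: 'a
    and invol :: "'a \<Rightarrow> 'a" +
  fixes m :: "'a measure"
  assumes haar: "left_haar m"
begin

definition convolution :: "('a \<Rightarrow> complex) \<Rightarrow> ('a \<Rightarrow> complex) \<Rightarrow> 'a \<Rightarrow> complex" where
  "convolution f g x = (LINT y|m. f y * translate g (invol y) x)"

definition tilde :: "('a \<Rightarrow> complex) \<Rightarrow> 'a \<Rightarrow> complex" where
  "tilde f x = cnj (f (invol x))"

definition lam :: "'a \<Rightarrow> ('a \<Rightarrow> complex) \<Rightarrow> 'a \<Rightarrow> complex" where
  "lam x g y = translate g (invol x) y"

definition lam_L1 :: "('a \<Rightarrow> complex) \<Rightarrow> ('a \<Rightarrow> complex) \<Rightarrow> 'a \<Rightarrow> complex" where
  "lam_L1 f g y = (LINT x|m. f x * lam x g y)"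

definition Cstar_norm :: "('a \<Rightarrow> complex) \<Rightarrow> real" where
  "Cstar_norm f = L2_operator_norm m (lam_L1 f)"

text \<open>The dual of the completion of \<open>L\<^sup>1\<close> in \<^const>\<open>Cstar_norm\<close> is, isometrically, the space of
  linear functionals on \<open>L\<^sup>1\<close> that are bounded with respect to that norm. Each of them is
  integration against a unique bounded continuous function, by which it is represented here.\<close>

definition B_lam :: "('a \<Rightarrow> complex) set" where
  "B_lam = {u. continuous_on UNIV u \<and> bounded (range u) \<and>
              (\<exists>C. \<forall>f\<in>L1 m. norm (LINT x|m. u x * f x) \<le> C * Cstar_norm f)}"

definition B_norm :: "('a \<Rightarrow> complex) \<Rightarrow> real" where
  "B_norm u = (SUP f\<in>{f \<in> L1 m. Cstar_norm f \<le> 1}. norm (LINT x|m. u x * f x))"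

definition fourier_generators :: "('a \<Rightarrow> complex) set" where
  "fourier_generators = {convolution f (tilde f) | f. f \<in> Cc}"

definition fourier_span :: "('a \<Rightarrow> complex) set" where
  "fourier_span =
     {\<lambda>x. \<Sum>g\<in>S. c g * g x | S c. finite S \<and> S \<subseteq> fourier_generators}"

definition fourier_space :: "('a \<Rightarrow> complex) set" where
  "fourier_space = {u\<in>B_lam. \<forall>\<epsilon>>0. \<exists>v\<in>fourier_span. B_norm (\<lambda>x. u x - v x) < \<epsilon>}"

abbreviation fourier_norm :: "('a \<Rightarrow> complex) \<Rightarrow> real" where
  "fourier_norm \<equiv> B_norm"

definition LA :: "('a \<Rightarrow> complex) set" where
  "LA = L1 m \<inter> fourier_space"

definition LA_norm :: "('a \<Rightarrow> complex) \<Rightarrow> real" where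
  "LA_norm f = L1_norm m f + fourier_norm f"

end

locale regular_fourier_hypergroup = haar_hypergroup conv e invol m
  for conv :: "('a::t2_space set \<Rightarrow> complex) \<Rightarrow> ('a set \<Rightarrow> complex) \<Rightarrow> 'a set \<Rightarrow> complex"
    and e :: 'a
    and invol :: "'a \<Rightarrow> 'a"
    and m :: "'a measure" +
  assumes fourier_banach: "banach_function_algebra fourier_space fourier_norm"

end

theory Submission imports Defs begin

text \<open>
  The Fourier space is a Banach algebra, with norm \<open>N\<close> say, of continuous and hence Borel functions.
  Point evaluations are characters of it, and characters of a Banach algebra are contractive
  (\<open>norm_eval_le\<close>), so the supremum norm is dominated by \<open>N\<close>. This yields
  \<open>\<parallel>f g\<parallel>\<^sub>1 \<le> \<parallel>f\<parallel>\<^sub>1 N g\<close>, which makes \<open>\<parallel>\<cdot>\<parallel>\<^sub>1 + N\<close> submultiplicative.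
  It also shows that \<open>N\<close>-limits are pointwise limits, so by Fatou's lemma the \<open>N\<close>-limit of a
  sequence that is Cauchy in both norms is its \<open>L\<^sup>1\<close>-limit as well (\<open>L1_limit_of_pointwise\<close>).
  Hence \<open>L\<^sup>1 \<inter> A\<close> is a Banach algebra for every Banach algebra \<open>A\<close> of measurable functions
  (\<open>banach_function_algebra_L1_Int\<close>).
\<close>

lemma banach_function_algebraD:
  assumes "banach_function_algebra A N"
  shows banach_function_algebra_zero: "(\<lambda>_. 0) \<in> A"
    and banach_function_algebra_add: "\<And>f g. f \<in> A \<Longrightarrow> g \<in> A \<Longrightarrow> (\<lambda>x. f x + g x) \<in> A"
    and banach_function_algebra_scale: "\<And>f c. f \<in> A \<Longrightarrow> (\<lambda>x. c * f x) \<in> A"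
    and banach_function_algebra_mult: "\<And>f g. f \<in> A \<Longrightarrow> g \<in> A \<Longrightarrow> (\<lambda>x. f x * g x) \<in> A"
    and banach_function_algebra_norm_nonneg: "\<And>f. f \<in> A \<Longrightarrow> 0 \<le> N f"
    and banach_function_algebra_norm_eq_0: "\<And>f. f \<in> A \<Longrightarrow> N f = 0 \<longleftrightarrow> f = (\<lambda>_. 0)"
    and banach_function_algebra_norm_scale: "\<And>f c. f \<in> A \<Longrightarrow> N (\<lambda>x. c * f x) = norm c * N f"
    and banach_function_algebra_norm_add:
      "\<And>f g. f \<in> A \<Longrightarrow> g \<in> A \<Longrightarrow> N (\<lambda>x. f x + g x) \<le> N f + N g"
    and banach_function_algebra_norm_mult:
      "\<And>f g. f \<in> A \<Longrightarrow> g \<in> A \<Longrightarrow> N (\<lambda>x. f x * g x) \<le> N f * N g"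
    and banach_function_algebra_complete: "\<And>F::nat \<Rightarrow> 'a \<Rightarrow> complex. range F \<subseteq> A \<Longrightarrow>
        \<forall>\<epsilon>>0. \<exists>n0. \<forall>m\<ge>n0. \<forall>n\<ge>n0. N (\<lambda>x. F m x - F n x) < \<epsilon> \<Longrightarrow>
        \<exists>f\<in>A. (\<lambda>n. N (\<lambda>x. F n x - f x)) \<longlonglongrightarrow> 0"
  using assms unfolding banach_function_algebra_def by blast+

lemma banach_function_algebra_diff:
  assumes "banach_function_algebra A N" "f \<in> A" "g \<in> A"
  shows "(\<lambda>x. f x - g x) \<in> A"
  using banach_function_algebra_add[OF assms(1,2)
      banach_function_algebra_scale[OF assms(1,3), of "-1"]]
  by simp

lemma banach_function_algebra_norm_diff_commute:
  assumes "banach_function_algebra A N" "f \<in> A" "g \<in> A"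
  shows "N (\<lambda>x. f x - g x) = N (\<lambda>x. g x - f x)"
  using banach_function_algebra_norm_scale[OF assms(1)
      banach_function_algebra_diff[OF assms(1,3,2)], of "-1"]
  by simp

text \<open>If \<open>f(x) = 1\<close> and \<open>N f < 1\<close>, the geometric series \<open>f + f\<^sup>2 + \<dots>\<close> would converge in \<open>A\<close> to some
  \<open>v\<close> with \<open>v = f + f v\<close>; evaluation at \<open>x\<close> gives \<open>v(x) = 1 + v(x)\<close>.\<close>

lemma eval_eq_1_imp_norm_ge_1:
  assumes A: "banach_function_algebra A N" and f: "f \<in> A" and fx: "f x = 1"
  shows "1 \<le> N f"
proof (rule ccontr)
  assume "\<not> 1 \<le> N f"
  define r where "r = N f"
  have r: "0 \<le> r" "r < 1"
    using \<open>\<not> 1 \<le> N f\<close> banach_function_algebra_norm_nonneg[OF A f] by (auto simp: r_def)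
  note zero = banach_function_algebra_zero[OF A]
    and add = banach_function_algebra_add[OF A]
    and mult = banach_function_algebra_mult[OF A]
    and nonneg = banach_function_algebra_norm_nonneg[OF A]
    and definite = banach_function_algebra_norm_eq_0[OF A]
    and N_add = banach_function_algebra_norm_add[OF A]
    and N_mult = banach_function_algebra_norm_mult[OF A]
    and complete = banach_function_algebra_complete[OF A]
  have N0: "N (\<lambda>_. 0) = 0" using definite[OF zero] by simp
  note diff = banach_function_algebra_diff[OF A]
  note commute = banach_function_algebra_norm_diff_commute[OF A]
  \<comment> \<open>partial sums of the geometric series, written as Horner iterates so that consecutive
    tails differ by a factor \<open>f\<close>\<close>
  define s where "s n = ((\<lambda>g y. f y + f y * g y) ^^ n) (\<lambda>_. 0)" for n
  have s0: "s 0 = (\<lambda>_. 0)" and s_Suc: "s (Suc n) = (\<lambda>y. f y + f y * s n y)" for n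
    by (simp_all add: s_def)
  have sA: "s n \<in> A" for n
    by (induction n) (use zero add mult f in \<open>auto simp: s0 s_Suc\<close>)
  have N_s: "N (s n) \<le> r / (1 - r)" for n
  proof (induction n)
    case 0
    show ?case using r by (simp add: s0 N0)
  next
    case (Suc n)
    have "N (s (Suc n)) \<le> N f + N (\<lambda>y. f y * s n y)"
      unfolding s_Suc using N_add[OF f mult[OF f sA]] .
    also have "\<dots> \<le> r + r * N (s n)"
      using N_mult[OF f sA] by (simp add: r_def)
    also have "\<dots> \<le> r + r * (r / (1 - r))"
      using Suc r by (intro add_left_mono mult_left_mono) auto
    also have "\<dots> = r / (1 - r)"
      using r by (simp add: field_simps)
    finally show ?case .
  qed
  have tail: "N (\<lambda>y. s (n + k) y - s n y) \<le> r ^ n * (r / (1 - r))" for n k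
  proof (induction n)
    case 0
    show ?case using N_s[of k] by (simp add: s0)
  next
    case (Suc n)
    have "N (\<lambda>y. s (Suc n + k) y - s (Suc n) y) = N (\<lambda>y. f y * (s (n + k) y - s n y))"
      by (simp add: s_Suc algebra_simps)
    also have "\<dots> \<le> r * N (\<lambda>y. s (n + k) y - s n y)"
      unfolding r_def by (rule N_mult[OF f diff[OF sA sA]])
    also have "\<dots> \<le> r * (r ^ n * (r / (1 - r)))"
      using Suc r by (intro mult_left_mono) auto
    finally show ?case by (simp add: mult.assoc)
  qed
  have "\<exists>n0. \<forall>m\<ge>n0. \<forall>n\<ge>n0. N (\<lambda>y. s m y - s n y) < \<epsilon>" if "\<epsilon> > 0" for \<epsilon>
  proof -
    have "(\<lambda>n. r ^ n * (r / (1 - r))) \<longlonglongrightarrow> 0 * (r / (1 - r))"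
      using r by (intro tendsto_mult tendsto_const LIMSEQ_realpow_zero)
    then have "eventually (\<lambda>n. r ^ n * (r / (1 - r)) < \<epsilon>) sequentially"
      using that by (auto dest: order_tendstoD)
    then obtain n0 where n0: "\<And>n. n \<ge> n0 \<Longrightarrow> r ^ n * (r / (1 - r)) < \<epsilon>"
      unfolding eventually_sequentially by blast
    have le: "N (\<lambda>y. s m y - s n y) < \<epsilon>" if "n0 \<le> n" "n \<le> m" for m n
      using tail[of n "m - n"] n0[of n] that by simp
    show ?thesis
    proof (intro exI allI impI)
      fix m n assume "n0 \<le> m" "n0 \<le> n"
      then show "N (\<lambda>y. s m y - s n y) < \<epsilon>"
        using le[of n m] le[of m n] commute[OF sA sA, of m n] by (cases "n \<le> m") auto
    qed
  qed
  then obtain v where v: "v \<in> A" and lim: "(\<lambda>n. N (\<lambda>y. s n y - v y)) \<longlonglongrightarrow> 0"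
    using complete[of s] sA by blast
  define w where "w = (\<lambda>y. v y - (f y + f y * v y))"
  have wA: "w \<in> A"
    unfolding w_def by (intro diff add mult v f)
  have "N w \<le> N (\<lambda>y. s (Suc n) y - v y) + r * N (\<lambda>y. s n y - v y)" for n
  proof -
    have "w = (\<lambda>y. (v y - s (Suc n) y) + f y * (s n y - v y))"
      by (simp add: w_def s_Suc algebra_simps)
    then have "N w \<le> N (\<lambda>y. v y - s (Suc n) y) + N (\<lambda>y. f y * (s n y - v y))"
      using N_add[OF diff[OF v sA] mult[OF f diff[OF sA v]]] by simp
    then show ?thesis
      using N_mult[OF f diff[OF sA v], of n] commute[OF v sA, of "Suc n"] by (simp add: r_def)
  qed
  moreover have "(\<lambda>n. N (\<lambda>y. s (Suc n) y - v y) + r * N (\<lambda>y. s n y - v y)) \<longlonglongrightarrow> 0 + r * 0"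
    by (intro tendsto_add tendsto_mult tendsto_const lim LIMSEQ_Suc[OF lim])
  ultimately have "N w \<le> 0 + r * 0"
    by (intro LIMSEQ_le_const) auto
  then have "w = (\<lambda>_. 0)"
    using nonneg[OF wA] definite[OF wA] by simp
  then have "w x = 0" by simp
  then show False by (simp add: w_def fx)
qed

lemma norm_eval_le:
  assumes A: "banach_function_algebra A N" and f: "f \<in> A"
  shows "norm (f x) \<le> N f"
proof (cases "f x = 0")
  case True
  then show ?thesis using banach_function_algebra_norm_nonneg[OF A f] by simp
next
  case False
  note scale = banach_function_algebra_scale[OF A f, of "inverse (f x)"]
    banach_function_algebra_norm_scale[OF A f, of "inverse (f x)"]
  have "1 \<le> norm (inverse (f x)) * N f"
    using eval_eq_1_imp_norm_ge_1[OF A scale(1), of x] False by (simp add: scale(2))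
  then show ?thesis
    using False by (simp add: norm_inverse norm_divide field_simps)
qed

text \<open>Fatou's lemma bounds \<open>\<parallel>F\<^sub>n - f\<parallel>\<^sub>1\<close> by \<open>liminf\<^sub>k \<parallel>F\<^sub>n - F\<^sub>k\<parallel>\<^sub>1\<close>, so no almost
  everywhere convergent subsequence of an abstract \<open>L\<^sup>1\<close>-limit has to be identified with \<open>f\<close>.\<close>

lemma L1_limit_of_pointwise:
  fixes F :: "nat \<Rightarrow> 'a \<Rightarrow> complex"
  assumes F: "\<And>n. F n \<in> L1 m"
    and cauchy: "\<And>\<epsilon>. \<epsilon> > 0 \<Longrightarrow> \<exists>n0. \<forall>k\<ge>n0. \<forall>n\<ge>n0. L1_norm m (\<lambda>x. F k x - F n x) < \<epsilon>"
    and lim: "\<And>x. (\<lambda>n. F n x) \<longlonglongrightarrow> f x"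
  shows "f \<in> L1 m" "(\<lambda>n. L1_norm m (\<lambda>x. F n x - f x)) \<longlonglongrightarrow> 0"
proof -
  have int: "integrable m (F n)" for n
    using F by (simp add: L1_def)
  have [measurable]: "F n \<in> borel_measurable m" for n
    using int by (rule borel_measurable_integrable)
  have [measurable]: "f \<in> borel_measurable m"
    by (rule borel_measurable_LIMSEQ_metric[where f = F]) (use lim in auto)
  have fatou: "(\<integral>\<^sup>+x. ennreal (norm (F n x - f x)) \<partial>m) \<le> ennreal \<epsilon>"
    if \<epsilon>: "\<epsilon> > 0" and n: "n \<ge> n0"
      and n0: "\<forall>k\<ge>n0. \<forall>n\<ge>n0. L1_norm m (\<lambda>x. F k x - F n x) < \<epsilon>" for n n0 \<epsilon>
  proof -
    have "(\<lambda>k. ennreal (norm (F n x - F k x))) \<longlonglongrightarrow> ennreal (norm (F n x - f x))" for x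
      by (intro tendsto_ennrealI tendsto_norm tendsto_diff tendsto_const lim)
    then have "(\<integral>\<^sup>+x. ennreal (norm (F n x - f x)) \<partial>m) =
        (\<integral>\<^sup>+x. liminf (\<lambda>k. ennreal (norm (F n x - F k x))) \<partial>m)"
      by (intro nn_integral_cong lim_imp_Liminf[symmetric]) auto
    also have "\<dots> \<le> liminf (\<lambda>k. \<integral>\<^sup>+x. ennreal (norm (F n x - F k x)) \<partial>m)"
      by (rule nn_integral_liminf) measurable
    also have "\<dots> \<le> liminf (\<lambda>k::nat. ennreal \<epsilon>)"
    proof (rule Liminf_mono)
      have "(\<integral>\<^sup>+x. ennreal (norm (F n x - F k x)) \<partial>m) \<le> ennreal \<epsilon>" if "k \<ge> n0" for k
      proof -
        have "(\<integral>\<^sup>+x. ennreal (norm (F n x - F k x)) \<partial>m) =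
            ennreal (L1_norm m (\<lambda>x. F n x - F k x))"
          unfolding L1_norm_def
          by (rule nn_integral_eq_integral) (use int in auto)
        then show ?thesis
          using n0[rule_format, OF n that] by (simp add: ennreal_leI)
      qed
      then show "\<forall>\<^sub>F k in sequentially. (\<integral>\<^sup>+x. ennreal (norm (F n x - F k x)) \<partial>m) \<le> ennreal \<epsilon>"
        unfolding eventually_sequentially by blast
    qed
    also have "\<dots> = ennreal \<epsilon>"
      by (simp add: Liminf_const)
    finally show ?thesis .
  qed
  obtain n1 where "\<forall>k\<ge>n1. \<forall>n\<ge>n1. L1_norm m (\<lambda>x. F k x - F n x) < 1"
    using cauchy[of 1] by auto
  from fatou[OF _ order_refl this]
  have "(\<integral>\<^sup>+x. ennreal (norm (F n1 x - f x)) \<partial>m) < \<infinity>"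
    by (simp add: ennreal_one_less_top le_less_trans)
  then have "integrable m (\<lambda>x. F n1 x - f x)"
    by (intro integrableI_bounded) auto
  from Bochner_Integration.integrable_diff[OF int[of n1] this]
  have f_int: "integrable m f" by simp
  then show "f \<in> L1 m" by (simp add: L1_def)
  show "(\<lambda>n. L1_norm m (\<lambda>x. F n x - f x)) \<longlonglongrightarrow> 0"
  proof (rule LIMSEQ_I)
    fix r :: real assume "r > 0"
    then obtain n0 where n0: "\<forall>k\<ge>n0. \<forall>n\<ge>n0. L1_norm m (\<lambda>x. F k x - F n x) < r / 2"
      using cauchy[of "r / 2"] by auto
    have "norm (L1_norm m (\<lambda>x. F n x - f x) - 0) < r" if "n \<ge> n0" for n
    proof -
      have "ennreal (L1_norm m (\<lambda>x. F n x - f x)) = (\<integral>\<^sup>+x. ennreal (norm (F n x - f x)) \<partial>m)"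
        unfolding L1_norm_def
        by (rule nn_integral_eq_integral[symmetric]) (use int f_int in auto)
      also have "\<dots> \<le> ennreal (r / 2)"
        using fatou[OF _ that n0] \<open>r > 0\<close> by simp
      finally have "L1_norm m (\<lambda>x. F n x - f x) \<le> r / 2"
        using \<open>r > 0\<close> by (simp add: ennreal_le_iff)
      moreover have "0 \<le> L1_norm m (\<lambda>x. F n x - f x)"
        by (simp add: L1_norm_def)
      ultimately show ?thesis using \<open>r > 0\<close> by simp
    qed
    then show "\<exists>n0. \<forall>n\<ge>n0. norm (L1_norm m (\<lambda>x. F n x - f x) - 0) < r" by blast
  qed
qed

lemma L1_mult_bounded:
  assumes f: "f \<in> L1 m" and g: "g \<in> borel_measurable m" and le: "\<And>x. norm (g x) \<le> B"
  shows "(\<lambda>x. f x * g x) \<in> L1 m" "L1_norm m (\<lambda>x. f x * g x) \<le> L1_norm m f * B"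
proof -
  have int: "integrable m f" using f by (simp add: L1_def)
  have bound: "norm (f x * g x) \<le> norm (f x) * B" for x
    using le by (simp add: norm_mult mult_left_mono)
  have fB: "integrable m (\<lambda>x. norm (f x) * B)"
    using int by simp
  have fg: "integrable m (\<lambda>x. f x * g x)"
  proof (rule Bochner_Integration.integrable_bound[OF fB])
    show "(\<lambda>x. f x * g x) \<in> borel_measurable m"
      using borel_measurable_integrable[OF int] g by simp
    show "AE x in m. norm (f x * g x) \<le> norm (norm (f x) * B)"
      using bound by (auto intro: order_trans[OF _ abs_ge_self])
  qed
  then show "(\<lambda>x. f x * g x) \<in> L1 m" by (simp add: L1_def)
  have "L1_norm m (\<lambda>x. f x * g x) \<le> (LINT x|m. norm (f x) * B)"
    unfolding L1_norm_def using fg fB bound by (intro integral_mono) auto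
  then show "L1_norm m (\<lambda>x. f x * g x) \<le> L1_norm m f * B"
    by (simp add: L1_norm_def)
qed

theorem banach_function_algebra_L1_Int:
  assumes A: "banach_function_algebra A N" and meas: "A \<subseteq> borel_measurable m"
  shows "banach_function_algebra (L1 m \<inter> A) (\<lambda>f. L1_norm m f + N f)"
proof -
  note zero = banach_function_algebra_zero[OF A]
    and add = banach_function_algebra_add[OF A]
    and scale = banach_function_algebra_scale[OF A]
    and mult = banach_function_algebra_mult[OF A]
    and nonneg = banach_function_algebra_norm_nonneg[OF A]
    and definite = banach_function_algebra_norm_eq_0[OF A]
    and N_scale = banach_function_algebra_norm_scale[OF A]
    and N_add = banach_function_algebra_norm_add[OF A]
    and N_mult = banach_function_algebra_norm_mult[OF A]
    and diff = banach_function_algebra_diff[OF A]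
  have L1_nonneg: "0 \<le> L1_norm m f" for f :: "'a \<Rightarrow> complex"
    by (simp add: L1_norm_def)
  have L1_mult: "(\<lambda>x. f x * g x) \<in> L1 m"
      "L1_norm m (\<lambda>x. f x * g x) \<le> L1_norm m f * N g"
    if "f \<in> L1 m" "g \<in> A" for f g
    using L1_mult_bounded[OF that(1), of g "N g"] norm_eval_le[OF A that(2)] meas that(2) by auto
  have L1_add: "L1_norm m (\<lambda>x. f x + g x) \<le> L1_norm m f + L1_norm m g"
    if "f \<in> L1 m" "g \<in> L1 m" for f g
  proof -
    have "L1_norm m (\<lambda>x. f x + g x) \<le> (LINT x|m. norm (f x) + norm (g x))"
      unfolding L1_norm_def
      by (intro integral_mono norm_triangle_ineq) (use that in \<open>auto simp: L1_def\<close>)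
    then show ?thesis using that by (simp add: L1_norm_def L1_def)
  qed
  have norm_mult_le: "L1_norm m (\<lambda>x. f x * g x) + N (\<lambda>x. f x * g x) \<le>
      (L1_norm m f + N f) * (L1_norm m g + N g)" if "f \<in> L1 m" "f \<in> A" "g \<in> A" for f g
  proof -
    have "L1_norm m (\<lambda>x. f x * g x) + N (\<lambda>x. f x * g x) \<le> (L1_norm m f + N f) * N g"
      using L1_mult(2)[OF that(1,3)] N_mult[OF that(2,3)] by (simp add: algebra_simps)
    also have "\<dots> \<le> (L1_norm m f + N f) * (L1_norm m g + N g)"
      using L1_nonneg nonneg[OF that(2)] by (intro mult_left_mono) auto
    finally show ?thesis .
  qed
  have complete: "\<exists>f\<in>L1 m \<inter> A. (\<lambda>n. L1_norm m (\<lambda>x. F n x - f x) + N (\<lambda>x. F n x - f x)) \<longlonglongrightarrow> 0"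
    if F: "range F \<subseteq> L1 m \<inter> A"
      and cauchy: "\<forall>\<epsilon>>0. \<exists>n0. \<forall>k\<ge>n0. \<forall>n\<ge>n0.
        L1_norm m (\<lambda>x. F k x - F n x) + N (\<lambda>x. F k x - F n x) < \<epsilon>"
    for F :: "nat \<Rightarrow> 'a \<Rightarrow> complex"
  proof -
    have FA: "F n \<in> A" and FL: "F n \<in> L1 m" for n
      using F by auto
    have cauchy_N: "\<forall>\<epsilon>>0. \<exists>n0. \<forall>k\<ge>n0. \<forall>n\<ge>n0. N (\<lambda>x. F k x - F n x) < \<epsilon>"
      using cauchy L1_nonneg by (meson add_increasing order_refl order_le_less_trans)
    have cauchy_L1: "\<exists>n0. \<forall>k\<ge>n0. \<forall>n\<ge>n0. L1_norm m (\<lambda>x. F k x - F n x) < \<epsilon>" if "\<epsilon> > 0" for \<epsilon>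
      using cauchy that nonneg[OF diff[OF FA FA]]
      by (meson add_increasing2 order_refl order_le_less_trans)
    obtain f where f: "f \<in> A" and lim_N: "(\<lambda>n. N (\<lambda>x. F n x - f x)) \<longlonglongrightarrow> 0"
      using banach_function_algebra_complete[OF A _ cauchy_N] FA by blast
    have "(\<lambda>n. F n x) \<longlonglongrightarrow> f x" for x
    proof -
      have "(\<lambda>n. F n x - f x) \<longlonglongrightarrow> 0"
        using norm_eval_le[OF A diff[OF FA f]] by (intro Lim_null_comparison[OF _ lim_N]) auto
      then show ?thesis by (simp add: LIM_zero_iff)
    qed
    note L1_lim = L1_limit_of_pointwise[OF FL cauchy_L1 this]
    show ?thesis
      using f L1_lim(1) tendsto_add[OF L1_lim(2) lim_N] by auto
  qed
  show ?thesis
    unfolding banach_function_algebra_def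
  proof (intro conjI ballI allI impI)
    fix f assume f: "f \<in> L1 m \<inter> A"
    show "L1_norm m f + N f = 0 \<longleftrightarrow> f = (\<lambda>_. 0)"
    proof
      assume "L1_norm m f + N f = 0"
      then show "f = (\<lambda>_. 0)"
        using f L1_nonneg[of f] nonneg[of f] definite[of f] by auto
    next
      assume "f = (\<lambda>_. 0)"
      then show "L1_norm m f + N f = 0"
        using definite[of f] f by (simp add: L1_norm_def)
    qed
  next
    fix f g assume "f \<in> L1 m \<inter> A" "g \<in> L1 m \<inter> A"
    then show "L1_norm m (\<lambda>x. f x + g x) + N (\<lambda>x. f x + g x) \<le>
        L1_norm m f + N f + (L1_norm m g + N g)"
      using L1_add[of f g] N_add[of f g] by auto
  next
    fix F :: "nat \<Rightarrow> 'a \<Rightarrow> complex"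
    assume "range F \<subseteq> L1 m \<inter> A \<and> (\<forall>\<epsilon>>0. \<exists>n0. \<forall>k\<ge>n0. \<forall>n\<ge>n0.
      L1_norm m (\<lambda>x. F k x - F n x) + N (\<lambda>x. F k x - F n x) < \<epsilon>)"
    then show "\<exists>f\<in>L1 m \<inter> A.
        (\<lambda>n. L1_norm m (\<lambda>x. F n x - f x) + N (\<lambda>x. F n x - f x)) \<longlonglongrightarrow> 0"
      using complete by blast
  qed (use zero add scale mult L1_mult norm_mult_le L1_nonneg nonneg N_scale
      in \<open>auto simp: L1_def L1_norm_def norm_mult algebra_simps\<close>)
qed

theorem proposition3p3:
  fixes conv :: "('a::t2_space set \<Rightarrow> complex) \<Rightarrow> ('a set \<Rightarrow> complex) \<Rightarrow> 'a set \<Rightarrow> complex"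
    and e :: 'a
    and invol :: "'a \<Rightarrow> 'a"
    and m :: "'a measure"
  assumes "regular_fourier_hypergroup conv e invol m"
  shows "banach_function_algebra
           (haar_hypergroup.LA conv invol m) (haar_hypergroup.LA_norm conv invol m)"
proof -
  interpret regular_fourier_hypergroup conv e invol m by fact
  have sets: "sets m = sets borel"
    using haar by (simp add: left_haar_def radon_measure_def)
  have "fourier_space \<subseteq> borel_measurable m"
    by (auto simp: fourier_space_def B_lam_def measurable_cong_sets[OF sets refl]
        intro: borel_measurable_continuous_onI)
  from banach_function_algebra_L1_Int[OF fourier_banach this]
  show ?thesis by (simp add: LA_def LA_norm_def[abs_def])
qed

end
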